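(* Let $k,\ell,m\ge 1$ be integers, let $M=\{f_1,\dots,f_m\}\subset\mathbf{R}^k$, and let $$\Lambda(a_1,\dots,a_m)=\int_{\mathbf{R}^{k\ell}}\prod_{j=1}^m a_j(f_j\cdot x)\,dx,\qquad a_j\in L^1(\mathbf{R}^\ell)\cap L^\infty(\mathbf{R}^\ell).$$ Let $\Omega_M\subset[0,1]^m$ be the (basis) matroid polytope of $M$. Then for every $\theta=(\theta_1,\dots,\theta_m)\in\Omega_M$ and all $a_1,\dots,a_m\in L^1(\mathbf{R}^\ell)\cap L^\infty(\mathbf{R}^\ell)$, $$|\Lambda(a_1,\dots,a_m)|\le C\prod_{i=1}^m\|a_i\|_{\theta_i},$$ where $C=\max\{|\det\hat B|^{-\ell}: B\subset M\text{ is a basis for }\mathbf{R}^k\}$.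
   Context: For $x=(x_1,\dots,x_k)\in\mathbf{R}^{k\ell}$ with each $x_i\in\mathbf{R}^\ell$ and $f_j=(f_{j1},\dots,f_{jk})\in\mathbf{R}^k$, set $f_j\cdot x=\sum_{i=1}^k f_{ji}x_i\in\mathbf{R}^\ell$. The notation $\|f\|_{1/p}$ denotes the $L^p$ norm of $f$, with $1/\infty=0$; so $\|a\|_{\theta}$ is the norm in $L^{1/\theta}(\mathbf{R}^\ell)$, and $\|a\|_0$ is the $L^\infty$ norm. For $S\subset M$, $\chi_S\in\{0,1\}^m$ is the vector whose $i$th component is $1$ if $f_i\in S$ and $0$ otherwise. The matroid polytope $\Omega_M$ is the convex hull of $\{\chi_B: B\subset M \text{ is a basis for }\mathbf{R}^k\}$. For a basis $B\subset M$, $\hat B$ is the $k\times k$ matrix whose rows are the elements of $B$.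
   Formalization: The f_j are taken to be distinct and nonzero: if f_j = 0, the factor a_j(0) is not defined for a class in L^1 ∩ L^∞ and the bound fails for some representatives; with repeated f_j, the given definition of χ_S makes the bound false. *)

theory Defs
  imports "HOL-Probability.Essential_Supremum"
begin

text \<open>
  \<open>(real^'l)^'k\<close> is the space of \<open>x = (x\<^sub>1, \<dots>, x\<^sub>k)\<close> with each \<open>x\<^sub>i \<in> R\<^sup>l\<close>, where
  \<open>k = CARD('k)\<close> and \<open>l = CARD('l)\<close>.
\<close>

definition fdot :: "real^'k \<Rightarrow> (real^'l)^'k \<Rightarrow> real^'l"
  where "fdot v x = (\<Sum>i\<in>UNIV. (v $ i) *\<^sub>R (x $ i))"

text \<open>
  Functions are representatives of classes modulo Lebesgue-null sets. The composition
  \<open>\<lambda>x. a j (fdot (f j) x)\<close> respects these classes exactly when \<open>f j \<noteq> 0\<close>; for \<open>f j = 0\<close> it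
  is the constant \<open>a j 0\<close>, which depends on the representative.
\<close>

definition L1_Linf :: "(real^'l \<Rightarrow> complex) set"
  where "L1_Linf = {a. integrable lebesgue a \<and> esssup lebesgue (\<lambda>y. ereal (norm (a y))) < \<infinity>}"

text \<open>The norm of \<open>L\<^sup>p\<close> for \<open>p = 1 / \<theta>\<close>, where \<open>p = \<infinity>\<close> if \<open>\<theta> = 0\<close>.\<close>

definition Lnorm :: "real \<Rightarrow> (real^'l \<Rightarrow> complex) \<Rightarrow> real"
  where "Lnorm \<theta> a =
    (if \<theta> = 0 then real_of_ereal (esssup lebesgue (\<lambda>y. ereal (norm (a y))))
     else (\<integral>y. norm (a y) powr (1 / \<theta>) \<partial>lebesgue) powr \<theta>)"

definition Lambda_form :: "('m::finite \<Rightarrow> real^'k) \<Rightarrow> ('m \<Rightarrow> real^'l \<Rightarrow> complex) \<Rightarrow> complex"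
  where "Lambda_form f a = (\<integral>x. (\<Prod>j\<in>UNIV. a j (fdot (f j) x)) \<partial>lebesgue)"

definition bases :: "(real^'k) set \<Rightarrow> (real^'k) set set"
  where "bases M = {B. B \<subseteq> M \<and> independent B \<and> span B = UNIV}"

definition chi_vec :: "('m::finite \<Rightarrow> real^'k) \<Rightarrow> (real^'k) set \<Rightarrow> real^'m"
  where "chi_vec f S = (\<chi> i. if f i \<in> S then 1 else 0)"

definition matroid_polytope :: "('m::finite \<Rightarrow> real^'k) \<Rightarrow> (real^'m) set"
  where "matroid_polytope f = convex hull (chi_vec f ` bases (range f))"

text \<open>
  For a basis \<open>B\<close>, which has exactly \<open>CARD('k)\<close> elements, each matrix with \<open>rows A = B\<close> lists every
  element of \<open>B\<close> exactly once. The choice of the order affects only the sign of the determinant.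
\<close>

definition basis_matrix :: "(real^'k) set \<Rightarrow> real^'k^'k"
  where "basis_matrix B = (SOME A. rows A = B)"

text \<open>The maximum ranges over a nonempty set whenever \<open>M\<close> is finite and spans.\<close>

definition det_const :: "nat \<Rightarrow> (real^'k) set \<Rightarrow> real"
  where "det_const l M = Max ((\<lambda>B. \<bar>det (basis_matrix B)\<bar> powi (- int l)) ` bases M)"

end

theory Submission
  imports Defs
begin

text \<open>
  At a vertex \<open>\<chi>\<^sub>B\<close> of the polytope the inequality is elementary. The factors with \<open>f j \<notin> B\<close> are bounded
  by their essential suprema, and the change of variables \<open>y\<^sub>i = f\<^sub>i \<cdot> x\<close> for the elements \<open>f\<^sub>i\<close> of \<open>B\<close> splits
  the remaining integral into \<open>\<bar>det B\<bar>\<^sup>-\<^sup>l\<close> times a product of \<open>L\<^sup>1\<close> norms.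

  The form is dominated by its values on nonnegative functions, and for these a convex combination
  \<open>\<theta> = \<Sum>\<^sub>B w\<^sub>B \<chi>\<^sub>B\<close> of vertices is reached by a pointwise inequality, without complex
  interpolation. Put \<open>c\<^sub>j = \<bar>a\<^sub>j\<bar> powr (1 / \<theta>\<^sub>j) / I\<^sub>j\<close>, where \<open>I\<^sub>j\<close> is the integral of the numerator and
  \<open>I\<^sub>j powr \<theta>\<^sub>j\<close> is thus the norm \<open>N\<^sub>j\<close> of \<open>a\<^sub>j\<close>; in the degenerate cases put \<open>c\<^sub>j = 1\<close> if \<open>\<theta>\<^sub>j = 0\<close>, and \<open>c\<^sub>j = 0\<close> if
  \<open>\<theta>\<^sub>j > 0\<close> and \<open>I\<^sub>j = 0\<close>. Then
  \<open>\<bar>a\<^sub>j\<bar> \<le> N\<^sub>j * c\<^sub>j powr \<theta>\<^sub>j\<close> almost everywhere (\<open>normalized_profile\<close>). By the weighted inequality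
  of means (\<open>prod_powr_le_weighted_sum\<close>),
  \<open>\<Prod>\<^sub>j c\<^sub>j powr \<theta>\<^sub>j \<le> \<Sum>\<^sub>B w\<^sub>B (\<Prod>j\<in>B. c\<^sub>j)\<close>.
  At the points \<open>f\<^sub>j \<cdot> x\<close>, the term of \<open>B\<close> on the right integrates to at most \<open>w\<^sub>B \<bar>det B\<bar>\<^sup>-\<^sup>l\<close>
  (\<open>nn_integral_prod_basis_le\<close>), and the weights add up to \<open>1\<close>. The domination also yields integrability.

  Two facts about Lebesgue measure support this. The map \<open>x \<mapsto> (f\<^sub>i \<cdot> x)\<^sub>i\<close> on \<open>(R\<^sup>l)\<^sup>k\<close> has Jacobian
  \<open>det ^ l\<close> (\<open>nn_integral_row_action\<close>, by reduction to elementary matrices). And preimages of null sets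
  under \<open>x \<mapsto> v \<cdot> x\<close> are null if \<open>v \<noteq> 0\<close> (\<open>AE_lborel_fdot\<close>); this carries the almost everywhere
  statements about the \<open>a\<^sub>j\<close> to \<open>(R\<^sup>l)\<^sup>k\<close>.
\<close>

section \<open>Lebesgue measure on vectors of vectors\<close>

lemma borel_measurable_linear:
  fixes f :: "'a::euclidean_space \<Rightarrow> 'b::euclidean_space"
  assumes "linear f"
  shows "f \<in> borel_measurable borel"
  using assms by (intro borel_measurable_continuous_onI linear_continuous_on) (simp add: linear_conv_bounded_linear)

lemma measurable_vec_lambda_PiM:
  "(vec_lambda :: ('k \<Rightarrow> 'a::euclidean_space) \<Rightarrow> 'a^'k::finite)
    \<in> PiM UNIV (\<lambda>_. lborel) \<rightarrow>\<^sub>M borel"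
proof -
  have axis: "(axis i :: 'a \<Rightarrow> 'a^'k) \<in> borel_measurable lborel" for i
    unfolding measurable_lborel2 by (intro borel_measurable_linear linearI) (auto simp: axis_def vec_eq_iff)
  have "(\<lambda>g :: 'k \<Rightarrow> 'a. \<Sum>i\<in>UNIV. axis i (g i)) \<in> PiM UNIV (\<lambda>_. lborel) \<rightarrow>\<^sub>M borel"
    by (intro borel_measurable_sum measurable_compose[OF _ axis] measurable_component_singleton) auto
  also have "(\<lambda>g :: 'k \<Rightarrow> 'a. \<Sum>i\<in>UNIV. axis i (g i)) = vec_lambda"
    by (auto simp: fun_eq_iff vec_eq_iff axis_def if_distrib cong: if_cong)
  finally show ?thesis .
qed

text \<open>
  The standard basis of \<open>'a^'k\<close> is indexed by pairs of a coordinate and a basis vector of \<open>'a\<close>.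
  This is what turns volumes of boxes in \<open>'a^'k\<close> into products of volumes of boxes in \<open>'a\<close>, and
  \<open>\<bar>det A\<bar>\<close> into \<open>\<bar>det A\<bar> ^ l\<close> for \<open>'a = real^'l\<close>.
\<close>

lemma prod_Basis_vec:
  fixes h :: "'a::euclidean_space^'k::finite \<Rightarrow> 'b::comm_monoid_mult"
  shows "(\<Prod>b\<in>Basis. h b) = (\<Prod>i\<in>UNIV. \<Prod>u\<in>Basis. h (axis i u))"
proof -
  have Basis: "(Basis :: ('a^'k) set) = (\<lambda>(i, u). axis i u) ` (UNIV \<times> Basis)"
    by (auto simp: Basis_vec_def)
  have inj: "inj_on (\<lambda>(i, u). axis i u :: 'a^'k) (UNIV \<times> Basis)"
    by (auto simp: inj_on_def axis_eq_axis)
  have "(\<Prod>b\<in>Basis. h b) = (\<Prod>(i, u)\<in>UNIV \<times> Basis. h (axis i u))"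
    unfolding Basis prod.reindex[OF inj] by (simp add: case_prod_unfold o_def)
  then show ?thesis
    by (simp add: prod.cartesian_product)
qed

lemma vimage_vec_lambda_box:
  fixes l u :: "'a::euclidean_space^'k::finite"
  shows "vec_lambda -` box l u = Pi\<^sub>E UNIV (\<lambda>i. box (l $ i) (u $ i))"
  by (auto simp: mem_box Basis_vec_def inner_axis PiE_iff)

text \<open>
  Both measures give a box the product of its side lengths, and this determines Lebesgue measure.
  The identity makes Tonelli's theorem available one block \<open>x $ i\<close> at a time.
\<close>

lemma lborel_vec_eq_PiM:
  "lborel = distr (PiM UNIV (\<lambda>_::'k::finite. lborel)) borel
    (vec_lambda :: ('k \<Rightarrow> 'a::euclidean_space) \<Rightarrow> 'a^'k)"
proof (rule lborel_eqI)
  interpret product_sigma_finite "\<lambda>_::'k. lborel :: 'a measure" ..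
  fix l u :: "'a^'k"
  assume le: "\<And>b. b \<in> Basis \<Longrightarrow> l \<bullet> b \<le> u \<bullet> b"
  then have le': "l $ i \<bullet> b \<le> u $ i \<bullet> b" if "b \<in> Basis" for i b
    using that le[of "axis i b"] by (auto simp: Basis_vec_def inner_axis)
  have "emeasure (distr (PiM UNIV (\<lambda>_::'k. lborel)) borel vec_lambda) (box l u)
      = (\<Prod>i\<in>UNIV. emeasure lborel (box (l $ i) (u $ i)))"
    by (simp add: emeasure_distr[OF measurable_vec_lambda_PiM] vimage_vec_lambda_box space_PiM emeasure_PiM)
  also have "\<dots> = ennreal (\<Prod>i\<in>UNIV. \<Prod>b\<in>Basis. (u $ i - l $ i) \<bullet> b)"
    using le' by (simp add: emeasure_lborel_box prod_ennreal prod_nonneg inner_diff_left)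
  also have "\<dots> = ennreal (\<Prod>b\<in>Basis. (u - l) \<bullet> b)"
    by (simp add: prod_Basis_vec inner_axis)
  finally show "emeasure (distr (PiM UNIV (\<lambda>_::'k. lborel)) borel vec_lambda) (box l u)
      = ennreal (\<Prod>b\<in>Basis. (u - l) \<bullet> b)" .
qed simp

lemma nn_integral_lborel_vec:
  fixes g :: "'a::euclidean_space^'k::finite \<Rightarrow> ennreal"
  assumes "g \<in> borel_measurable borel"
  shows "(\<integral>\<^sup>+x. g x \<partial>lborel) = (\<integral>\<^sup>+y. g (vec_lambda y) \<partial>PiM UNIV (\<lambda>_::'k. lborel))"
  using assms by (subst lborel_vec_eq_PiM) (simp add: nn_integral_distr[OF measurable_vec_lambda_PiM])

lemma nn_integral_lborel_vec_prod:
  fixes h :: "'k::finite \<Rightarrow> 'a::euclidean_space \<Rightarrow> ennreal"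
  assumes [measurable]: "\<And>i. h i \<in> borel_measurable borel"
  shows "(\<integral>\<^sup>+x. (\<Prod>i\<in>UNIV. h i (x $ i)) \<partial>lborel) = (\<Prod>i\<in>UNIV. \<integral>\<^sup>+y. h i y \<partial>lborel)"
proof -
  interpret product_sigma_finite "\<lambda>_::'k. lborel :: 'a measure" ..
  have nth: "(\<lambda>x::'a^'k. x $ i) \<in> borel_measurable borel" for i
    by (intro borel_measurable_continuous_onI continuous_intros)
  have "(\<lambda>x. \<Prod>i\<in>UNIV. h i (x $ i)) \<in> borel_measurable borel"
    by (intro borel_measurable_prod_ennreal measurable_compose[OF nth]) simp
  then show ?thesis
    using product_nn_integral_prod[of UNIV h] by (simp add: nn_integral_lborel_vec)
qed

section \<open>Change of variables by block matrices\<close>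

text \<open>
  In coordinates this is the Kronecker product of \<open>A\<close> with the identity of \<open>R\<^sup>l\<close>: each of the \<open>l\<close>
  layers of \<open>x\<close> is multiplied by \<open>A\<close>, so that the Jacobian is \<open>det A ^ l\<close>.
\<close>

definition row_action :: "real^'k^'k \<Rightarrow> (real^'l)^'k \<Rightarrow> (real^'l)^'k"
  where "row_action A x = (\<chi> i. fdot (A $ i) x)"

lemma linear_fdot: "linear (fdot v)"
  by (auto intro!: linearI simp: fdot_def algebra_simps sum.distrib scaleR_sum_right)

lemma borel_measurable_fdot [measurable]: "fdot v \<in> borel_measurable borel"
  by (rule borel_measurable_linear[OF linear_fdot])

lemma linear_row_action: "linear (row_action A)"
  by (auto intro!: linearI simp: row_action_def vec_eq_iff linear_add[OF linear_fdot] linear_scale[OF linear_fdot])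

lemma borel_measurable_row_action [measurable]: "row_action A \<in> borel_measurable borel"
  by (rule borel_measurable_linear[OF linear_row_action])

text \<open>
  The action is multiplicative. Hence the change of variables needs to be verified only for the
  elementary matrices, whose actions are computed next.
\<close>

lemma row_action_mult: "row_action (A ** B) x = row_action A (row_action B x)"
  unfolding row_action_def fdot_def matrix_matrix_mult_def
  by (simp add: vec_eq_iff scaleR_sum_right sum_distrib_right, subst sum.swap) (simp add: mult.commute)

lemma row_action_diagonal:
  assumes "\<And>i j. i \<noteq> j \<Longrightarrow> A $ i $ j = 0"
  shows "row_action A x = (\<chi> i. (A $ i $ i) *\<^sub>R x $ i)"
proof -
  have "fdot (A $ i) x = (\<Sum>j\<in>UNIV. if j = i then (A $ i $ i) *\<^sub>R x $ i else 0)" for i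
    unfolding fdot_def using assms by (intro sum.cong) auto
  then show ?thesis by (simp add: row_action_def)
qed

lemma row_action_transposition:
  fixes x :: "(real^'l)^'k::finite" and m n :: 'k
  shows "row_action (\<chi> i j. mat 1 $ i $ Transposition.transpose m n j) x
    = (\<chi> i. x $ Transposition.transpose m n i)"
proof -
  have "mat 1 $ i $ Transposition.transpose m n j *\<^sub>R x $ j
      = (if j = Transposition.transpose m n i then x $ j else 0)" for i j
    by (auto simp: mat_def)
  then show ?thesis by (simp add: row_action_def fdot_def)
qed

lemma row_action_shear:
  assumes "m \<noteq> n"
  shows "row_action (\<chi> i j. of_bool (i = m \<and> j = n \<or> i = j)) x
    = (\<chi> i. if i = m then x $ n + x $ m else x $ i)"
proof -
  have "fdot (\<chi> j. of_bool (i = m \<and> j = n \<or> i = j)) x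
     = (\<Sum>j\<in>UNIV. (if j = n then of_bool (i = m) *\<^sub>R x $ n else 0) + (if j = i then x $ i else 0))" for i
    unfolding fdot_def using assms by (intro sum.cong) auto
  then show ?thesis by (simp add: row_action_def sum.distrib vec_eq_iff)
qed

text \<open>
  A block scaling is diagonal in the standard basis and scales each of the \<open>l\<close> basis directions of
  the block \<open>i\<close> by \<open>c i\<close>; the affine change of variables for Lebesgue measure applies.
\<close>

lemma nn_integral_coordinate_scaling:
  fixes g :: "(real^'l)^'k::finite \<Rightarrow> ennreal" and c :: "'k \<Rightarrow> real"
  assumes g [measurable]: "g \<in> borel_measurable borel" and c: "\<And>i. c i \<noteq> 0"
  shows "ennreal (\<bar>\<Prod>i\<in>UNIV. c i\<bar> ^ CARD('l)) * (\<integral>\<^sup>+x. g (\<chi> i. c i *\<^sub>R x $ i) \<partial>lborel)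
    = (\<integral>\<^sup>+x. g x \<partial>lborel)"
proof -
  \<comment> \<open>The scaling factor as a function of the basis vector: \<open>axis i u\<close> has its only nonzero block at \<open>i\<close>.\<close>
  define C :: "(real^'l)^'k \<Rightarrow> real" where "C b = c (THE i. b $ i \<noteq> 0)" for b
  have C_axis: "C (axis i u) = c i" if "u \<noteq> 0" for i u
    using that unfolding C_def by (auto intro!: arg_cong[where f=c] simp: axis_def split: if_splits)
  have C0: "C j \<noteq> 0" for j using c by (simp add: C_def)
  let ?T = "\<lambda>x. 0 + (\<Sum>j\<in>Basis. (C j * (x \<bullet> j)) *\<^sub>R j)"
  have T: "?T x = (\<chi> i. c i *\<^sub>R x $ i)" for x
  proof (rule euclidean_eqI)
    fix b :: "(real^'l)^'k" assume b: "b \<in> Basis"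
    then obtain i u where iu: "b = axis i u" "u \<in> Basis" by (auto simp: Basis_vec_def)
    then have "u \<noteq> 0" by (simp add: nonzero_Basis)
    have "?T x \<bullet> b = C b * (x \<bullet> b)"
      using b by (simp add: inner_sum_left_Basis)
    then show "?T x \<bullet> b = (\<chi> i. c i *\<^sub>R x $ i) \<bullet> b"
      using \<open>u \<noteq> 0\<close> by (simp add: iu C_axis inner_axis)
  qed
  have [measurable]: "(\<lambda>x :: (real^'l)^'k. \<chi> i. c i *\<^sub>R x $ i) \<in> borel_measurable borel"
    unfolding T[symmetric] by measurable
  have "(\<Prod>j\<in>Basis. \<bar>C j\<bar>) = \<bar>\<Prod>i\<in>UNIV. c i\<bar> ^ CARD('l)"
  proof -
    have "(\<Prod>u\<in>Basis. \<bar>C (axis i (u :: real^'l))\<bar>) = \<bar>c i\<bar> ^ CARD('l)" for i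
    proof -
      have "(\<Prod>u\<in>Basis. \<bar>C (axis i (u :: real^'l))\<bar>) = (\<Prod>u\<in>(Basis :: (real^'l) set). \<bar>c i\<bar>)"
        by (intro prod.cong) (auto simp: C_axis nonzero_Basis)
      then show ?thesis by simp
    qed
    then show ?thesis by (simp add: prod_Basis_vec prod_power_distrib abs_prod)
  qed
  with lborel_affine_euclidean[of C 0, OF C0]
  have "lborel = density (distr lborel borel (\<lambda>x :: (real^'l)^'k. \<chi> i. c i *\<^sub>R x $ i))
      (\<lambda>_. ennreal (\<bar>\<Prod>i\<in>UNIV. c i\<bar> ^ CARD('l)))"
    by (simp only: T)
  then have "(\<integral>\<^sup>+x. g x \<partial>lborel) = (\<integral>\<^sup>+x. g x \<partial>density (distr lborel borel (\<lambda>x :: (real^'l)^'k. \<chi> i. c i *\<^sub>R x $ i))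
      (\<lambda>_. ennreal (\<bar>\<Prod>i\<in>UNIV. c i\<bar> ^ CARD('l))))" by simp
  then show ?thesis
    by (simp add: nn_integral_density nn_integral_distr nn_integral_cmult)
qed

text \<open>
  A permutation of the blocks maps boxes to boxes of the same volume.
\<close>

lemma nn_integral_coordinate_permutation:
  fixes g :: "'a::euclidean_space^'k::finite \<Rightarrow> ennreal" and p :: "'k \<Rightarrow> 'k"
  assumes g [measurable]: "g \<in> borel_measurable borel" and p: "bij p"
  shows "(\<integral>\<^sup>+x. g (\<chi> i. x $ p i) \<partial>lborel) = (\<integral>\<^sup>+x. g x \<partial>lborel)"
proof -
  let ?T = "\<lambda>x :: 'a^'k. \<chi> i. x $ p i"
  have meas [measurable]: "?T \<in> borel_measurable borel"
    by (intro borel_measurable_continuous_onI continuous_intros)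
  have "lborel = distr lborel borel ?T"
  proof (rule lborel_eqI)
    fix l u :: "'a^'k" assume "\<And>b. b \<in> Basis \<Longrightarrow> l \<bullet> b \<le> u \<bullet> b"
    then have "l \<bullet> axis i b \<le> u \<bullet> axis i b" if "b \<in> Basis" for i b
      using that by (auto simp: Basis_vec_def)
    then have le: "l $ i \<bullet> b \<le> u $ i \<bullet> b" if "b \<in> Basis" for i b
      using that by (simp add: inner_axis)
    let ?q = "inv p"
    have q: "?q (p i) = i" "p (?q i) = i" for i
      using p by (auto simp: bij_def surj_f_inv_f)
    have "?T -` box l u = box (\<chi> i. l $ ?q i) (\<chi> i. u $ ?q i)"
      by (auto simp: mem_box Basis_vec_def inner_axis; metis q)
    moreover have "\<forall>b\<in>Basis. (\<chi> i. l $ ?q i) \<bullet> b \<le> (\<chi> i. u $ ?q i) \<bullet> b"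
      using le by (auto simp: Basis_vec_def inner_axis)
    ultimately have "emeasure (distr lborel borel ?T) (box l u)
        = ennreal (\<Prod>i\<in>UNIV. \<Prod>b\<in>Basis. (u $ ?q i - l $ ?q i) \<bullet> b)"
      by (simp add: emeasure_distr emeasure_lborel_box_eq prod_Basis_vec inner_axis inner_diff_left)
    also have "(\<Prod>i\<in>UNIV. \<Prod>b\<in>Basis. (u $ ?q i - l $ ?q i) \<bullet> b) = (\<Prod>i\<in>UNIV. \<Prod>b\<in>Basis. (u $ i - l $ i) \<bullet> b)"
      using p by (intro prod.reindex_bij_betw bij_imp_bij_inv)
    finally show "emeasure (distr lborel borel ?T) (box l u) = ennreal (\<Prod>b\<in>Basis. (u - l) \<bullet> b)"
      by (simp add: prod_Basis_vec inner_axis)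
  qed simp
  then have "(\<integral>\<^sup>+x. g x \<partial>lborel) = (\<integral>\<^sup>+x. g x \<partial>distr lborel borel ?T)" by simp
  then show ?thesis by (simp add: nn_integral_distr)
qed

text \<open>
  If the block \<open>m\<close> is integrated first, then the shear is a translation of it by the block \<open>n\<close>, which
  stays fixed in the inner integral.
\<close>

lemma nn_integral_coordinate_shear:
  fixes g :: "'a::euclidean_space^'k::finite \<Rightarrow> ennreal"
  assumes g [measurable]: "g \<in> borel_measurable borel" and "m \<noteq> n"
  shows "(\<integral>\<^sup>+x. g (\<chi> i. if i = m then x $ n + x $ m else x $ i) \<partial>lborel) = (\<integral>\<^sup>+x. g x \<partial>lborel)"
proof -
  interpret product_sigma_finite "\<lambda>_::'k. lborel :: 'a measure" ..
  let ?T = "\<lambda>x :: 'a^'k. \<chi> i. if i = m then x $ n + x $ m else x $ i"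
  have lin: "linear ?T"
    by (auto intro!: linearI simp: vec_eq_iff algebra_simps)
  have T [measurable]: "?T \<in> borel_measurable borel"
    by (rule borel_measurable_linear[OF lin])
  have vec: "(vec_lambda :: ('k \<Rightarrow> 'a) \<Rightarrow> 'a^'k) \<in> PiM (insert m (UNIV - {m})) (\<lambda>_. lborel) \<rightarrow>\<^sub>M borel"
    using measurable_vec_lambda_PiM by (simp add: insert_absorb)
  have Fubini: "(\<integral>\<^sup>+x. h x \<partial>lborel)
      = (\<integral>\<^sup>+x. \<integral>\<^sup>+y. h (vec_lambda (x(m := y))) \<partial>lborel \<partial>PiM (UNIV - {m}) (\<lambda>_. lborel))"
    if [measurable]: "h \<in> borel_measurable borel" for h :: "'a^'k \<Rightarrow> ennreal"
  proof -
    have "(\<integral>\<^sup>+x. h x \<partial>lborel) = (\<integral>\<^sup>+y. h (vec_lambda y) \<partial>PiM (insert m (UNIV - {m})) (\<lambda>_. lborel))"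
      using nn_integral_lborel_vec[OF that] by (simp add: insert_absorb)
    also have "\<dots> = (\<integral>\<^sup>+x. \<integral>\<^sup>+y. h (vec_lambda (x(m := y))) \<partial>lborel \<partial>PiM (UNIV - {m}) (\<lambda>_. lborel))"
      by (rule product_nn_integral_insert[OF _ _ measurable_compose[OF vec that]]) auto
    finally show ?thesis .
  qed
  have "(\<integral>\<^sup>+y. g (?T (vec_lambda (x(m := y)))) \<partial>lborel) = (\<integral>\<^sup>+y. g (vec_lambda (x(m := y))) \<partial>lborel)" for x
  proof -
    let ?h = "\<lambda>y. g (vec_lambda (x(m := y)))"
    have "continuous_on UNIV (\<lambda>y. (x(m := y)) i)" for i
      by (cases "i = m") auto
    then have "(\<lambda>y :: 'a. vec_lambda (x(m := y)) :: 'a^'k) \<in> borel_measurable borel"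
      by (intro borel_measurable_continuous_onI continuous_on_vec_lambda)
    then have h: "?h \<in> borel_measurable borel" by measurable
    have "?T (vec_lambda (x(m := y))) = vec_lambda (x(m := x n + y))" for y
      using \<open>m \<noteq> n\<close> by (auto simp: vec_eq_iff)
    then have "(\<integral>\<^sup>+y. g (?T (vec_lambda (x(m := y)))) \<partial>lborel) = (\<integral>\<^sup>+y. ?h (x n + y) \<partial>lborel)" by simp
    also have "\<dots> = (\<integral>\<^sup>+y. ?h y \<partial>distr lborel borel ((+) (x n)))"
      using h by (subst nn_integral_distr) auto
    also have "\<dots> = (\<integral>\<^sup>+y. ?h y \<partial>lborel)" by (simp only: lborel_distr_plus)
    finally show ?thesis .
  qed
  then show ?thesis
    by (simp add: Fubini)
qed

text \<open>
  Gaussian elimination: every matrix is a product of elementary ones and of matrices with a zero row,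
  and the latter are excluded by the determinant. The factor stands on the left, so that the two
  instances for \<open>A\<close> and \<open>B\<close> compose to the one for \<open>A ** B\<close> without any division in \<open>ennreal\<close>.
\<close>

proposition nn_integral_row_action:
  fixes g :: "(real^'l)^'k::finite \<Rightarrow> ennreal" and A :: "real^'k^'k"
  assumes "g \<in> borel_measurable borel" and "det A \<noteq> 0"
  shows "ennreal (\<bar>det A\<bar> ^ CARD('l)) * (\<integral>\<^sup>+x. g (row_action A x) \<partial>lborel) = (\<integral>\<^sup>+x. g x \<partial>lborel)"
  using assms
proof (induction A arbitrary: g rule: induct_matrix_elementary_alt
    [case_names mult zero_row diagonal swap1 idplus])
  case (mult A B)
  then have dets: "det A \<noteq> 0" "det B \<noteq> 0" by (auto simp: det_mul)
  note [measurable] = mult.prems(1)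
  have "(\<integral>\<^sup>+x. g x \<partial>lborel) = ennreal (\<bar>det A\<bar> ^ CARD('l)) *
      (ennreal (\<bar>det B\<bar> ^ CARD('l)) * (\<integral>\<^sup>+x. g (row_action A (row_action B x)) \<partial>lborel))"
    using mult.IH(2)[of "\<lambda>x. g (row_action A x)"] mult.IH(1)[of g] dets by simp
  then show ?case
    by (simp add: row_action_mult det_mul abs_mult power_mult_distrib ennreal_mult' mult.assoc)
next
  case (zero_row A i)
  then show ?case by (simp add: det_zero_row)
next
  case (diagonal A)
  then have "det A = (\<Prod>i\<in>UNIV. A $ i $ i)" by (simp add: det_diagonal)
  with diagonal show ?case
    using nn_integral_coordinate_scaling[of g "\<lambda>i. A $ i $ i"] by (simp add: row_action_diagonal)
next
  case (swap1 m n)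
  let ?A = "(\<chi> i j. mat 1 $ i $ Transposition.transpose m n j) :: real^'k^'k"
  have "\<bar>det ?A\<bar> = 1"
    using det_permute_columns[of "Transposition.transpose m n" "mat 1 :: real^'k^'k"] swap1
    by (simp add: permutes_swap_id sign_swap_id)
  with swap1 show ?case
    using nn_integral_coordinate_permutation[of g "Transposition.transpose m n"]
    by (simp add: row_action_transposition)
next
  case (idplus m n)
  let ?A = "(\<chi> i j. of_bool (i = m \<and> j = n \<or> i = j)) :: real^'k^'k"
  have "det (\<chi> i. if i = m then row m (mat 1 :: real^'k^'k) + 1 *s row n (mat 1) else row i (mat 1 :: real^'k^'k)) = 1"
    using idplus by (subst det_row_operation) auto
  also have "(\<chi> i. if i = m then row m (mat 1 :: real^'k^'k) + 1 *s row n (mat 1) else row i (mat 1 :: real^'k^'k)) = ?A"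
    using idplus by (auto simp: vec_eq_iff row_def mat_def)
  finally have det: "det ?A = 1" .
  show ?case
    unfolding row_action_shear[OF idplus(1)] det
    using idplus by (simp add: nn_integral_coordinate_shear)
qed

text \<open>
  Here the basis is given by the rows of \<open>A\<close>: in the coordinates \<open>y\<^sub>i = A\<^sub>i \<cdot> x\<close> the
  integrand splits into a product of functions of separate variables.
\<close>

lemma nn_integral_prod_row_action:
  fixes h :: "'k::finite \<Rightarrow> real^'l \<Rightarrow> ennreal" and A :: "real^'k^'k"
  assumes [measurable]: "\<And>i. h i \<in> borel_measurable borel" and "det A \<noteq> 0"
  shows "(\<integral>\<^sup>+x. (\<Prod>i\<in>UNIV. h i (fdot (A $ i) x)) \<partial>lborel)
    = ennreal (\<bar>det A\<bar> powi (- int CARD('l))) * (\<Prod>i\<in>UNIV. \<integral>\<^sup>+y. h i y \<partial>lborel)"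
proof -
  let ?d = "\<bar>det A\<bar> ^ CARD('l)"
  let ?I = "\<integral>\<^sup>+x. (\<Prod>i\<in>UNIV. h i (fdot (A $ i) x)) \<partial>lborel"
  have [measurable]: "(\<lambda>x::(real^'l)^'k. x $ i) \<in> borel_measurable borel" for i
    by (intro borel_measurable_continuous_onI continuous_intros)
  have "ennreal ?d * ?I = (\<integral>\<^sup>+x. (\<Prod>i\<in>UNIV. h i (x $ i)) \<partial>lborel)"
    using nn_integral_row_action[of "\<lambda>x. \<Prod>i\<in>UNIV. h i (x $ i)" A] \<open>det A \<noteq> 0\<close>
    by (simp add: row_action_def)
  also have "\<dots> = (\<Prod>i\<in>UNIV. \<integral>\<^sup>+y. h i y \<partial>lborel)"
    by (rule nn_integral_lborel_vec_prod) simp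
  finally have eq: "ennreal ?d * ?I = (\<Prod>i\<in>UNIV. \<integral>\<^sup>+y. h i y \<partial>lborel)" .
  have "\<bar>det A\<bar> powi (- int CARD('l)) * ?d = 1"
    using \<open>det A \<noteq> 0\<close> by (simp add: power_int_minus)
  then have "ennreal (\<bar>det A\<bar> powi (- int CARD('l))) * (ennreal ?d * ?I) = ?I"
    by (simp add: ennreal_mult'[symmetric] mult.assoc[symmetric])
  then show ?thesis by (simp add: eq)
qed

section \<open>Bases and their matrices\<close>

text \<open>
  A basis has \<open>k\<close> elements, so some matrix has it as its set of rows and the choice in
  \<open>basis_matrix\<close> is meaningful. By counting, no row of that matrix is repeated.
\<close>

lemma
  assumes "B \<in> bases M"
  shows rows_basis_matrix: "range (\<lambda>i. basis_matrix B $ i) = B"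
    and inj_basis_matrix: "inj (\<lambda>i. basis_matrix B $ i)"
    and det_basis_matrix_nonzero: "det (basis_matrix B) \<noteq> 0"
proof -
  have rows_eq: "rows A = range (\<lambda>i. A $ i)" for A :: "real^'a^'a"
    by (auto simp: rows_def row_def)
  have B: "independent B" "span B = UNIV" using assms by (auto simp: bases_def)
  then have card: "card B = CARD('a)" and "finite B"
    using basis_card_eq_dim[of B UNIV] independent_imp_finite by (auto simp: dim_UNIV)
  then obtain e where "bij_betw e (UNIV :: 'a set) B"
    by (metis finite_same_card_bij finite)
  then have "rows (\<chi> i. e i) = B" by (auto simp: rows_eq bij_betw_def)
  then have rows: "rows (basis_matrix B) = B" unfolding basis_matrix_def by (rule someI)
  then show range: "range (\<lambda>i. basis_matrix B $ i) = B" by (simp add: rows_eq)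
  then show "inj (\<lambda>i. basis_matrix B $ i)" by (intro eq_card_imp_inj_on) (auto simp: card)
  show "det (basis_matrix B) \<noteq> 0"
    using B(2) matrix_left_invertible_span_rows[of "basis_matrix B"]
    by (auto simp: rows span_vec_eq invertible_det_nz[symmetric] invertible_left_inverse)
qed

lemma finite_bases: "finite M \<Longrightarrow> finite (bases M)"
  by (rule finite_subset[of _ "Pow M"]) (auto simp: bases_def)

lemma det_const_ge:
  assumes "finite M" and "B \<in> bases M"
  shows "\<bar>det (basis_matrix B)\<bar> powi (- int n) \<le> det_const n M"
  unfolding det_const_def using assms by (auto intro!: Max_ge simp: finite_bases)

section \<open>Composition with a nonzero functional\<close>

text \<open>
  Extend \<open>v\<close> to a basis. In the coordinates of that basis the preimage of a null set \<open>N\<close> is a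
  product with \<open>N\<close> as one of its factors, so it is null, even if the other factors have infinite measure.
  For \<open>v = 0\<close> the claim fails, since \<open>fdot v\<close> is then constant.
\<close>

lemma AE_lborel_fdot:
  fixes v :: "real^'k" and P :: "real^'l \<Rightarrow> bool"
  assumes "v \<noteq> 0" and "AE y in lborel. P y"
  shows "AE x in lborel. P (fdot v x)"
proof -
  obtain N where N: "N \<in> null_sets lborel" "{y. \<not> P y} \<subseteq> N"
    using assms(2) by (auto simp: eventually_ae_filter)
  have [measurable]: "N \<in> sets borel" using N(1) by auto
  have "independent {v}" using assms(1) by simp
  then obtain B where B: "{v} \<subseteq> B" "independent B" "span B = UNIV"
    by (metis maximal_independent_subset_extend[of "{v}" UNIV] subset_UNIV top.extremum_uniqueI)
  then have base: "B \<in> bases B" by (simp add: bases_def)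
  define A where "A = basis_matrix B"
  obtain i where i: "A $ i = v"
    using rows_basis_matrix[OF base] B(1) unfolding A_def by (metis imageE insert_subset)
  let ?h = "\<lambda>j y. if j = i then indicator N y else 1 :: ennreal"
  have "(\<integral>\<^sup>+x. (\<Prod>j\<in>UNIV. ?h j (fdot (A $ j) x)) \<partial>lborel)
      = ennreal (\<bar>det A\<bar> powi (- int CARD('l))) * (\<Prod>j\<in>UNIV. \<integral>\<^sup>+y. ?h j y \<partial>(lborel :: (real^'l) measure))"
    using det_basis_matrix_nonzero[OF base] by (intro nn_integral_prod_row_action) (auto simp: A_def)
  also have "(\<Prod>j\<in>UNIV. \<integral>\<^sup>+y. ?h j y \<partial>(lborel :: (real^'l) measure)) = 0"
    using N(1) by (intro prod_zero bexI[of _ i]) auto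
  also have "(\<lambda>x. \<Prod>j\<in>UNIV. ?h j (fdot (A $ j) x)) = (\<lambda>x. indicator N (fdot v x))"
    by (simp add: i fun_eq_iff if_distrib cong: if_cong)
  finally have "AE x in lborel. indicator N (fdot v x) = (0 :: ennreal)"
    by (subst (asm) mult_zero_right, subst (asm) nn_integral_0_iff_AE) auto
  then show ?thesis
    using N(2) by (auto elim!: eventually_mono simp: indicator_def split: if_splits)
qed

text \<open>
  Linear maps are Borel measurable, but measurability from Lebesgue sets to Lebesgue sets also needs that
  preimages of null sets are null.
\<close>

lemma measurable_fdot_lebesgue:
  assumes "v \<noteq> 0"
  shows "(fdot v :: (real^'l)^'k \<Rightarrow> real^'l) \<in> lebesgue \<rightarrow>\<^sub>M lebesgue"
proof (rule completion.measurable_completion2)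
  show meas: "(fdot v :: (real^'l)^'k \<Rightarrow> real^'l) \<in> lebesgue \<rightarrow>\<^sub>M lborel"
    by (simp add: measurable_completion)
  show "null_sets lborel \<subseteq> null_sets (distr lebesgue lborel (fdot v :: (real^'l)^'k \<Rightarrow> real^'l))"
  proof
    fix N :: "(real^'l) set" assume N: "N \<in> null_sets lborel"
    then have "AE x in lborel. fdot v x \<notin> N"
      using AE_lborel_fdot[OF assms AE_not_in] by blast
    then show "N \<in> null_sets (distr lebesgue lborel (fdot v :: (real^'l)^'k \<Rightarrow> real^'l))"
      using N by (auto simp: null_sets_distr_iff[OF meas] completion.null_sets_iff_AE AE_completion_iff)
  qed
qed

section \<open>The pointwise inequality\<close>

text \<open>
  The weighted inequality of arithmetic and geometric means, applied to the numbers
  \<open>\<Prod>j\<in>J b. c j\<close> with the weights \<open>w b\<close>: in their geometric mean, \<open>c j\<close> has the total weight of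
  those \<open>b\<close> for which \<open>j \<in> J b\<close>. For positive \<open>c\<close> this is convexity of \<open>exp\<close> at the logarithms. If some
  \<open>c j\<close> vanishes then so does the left-hand side, even for exponent \<open>0\<close>, because \<open>0 powr 0 = 0\<close>.
\<close>

lemma prod_powr_le_weighted_sum:
  fixes w :: "'b \<Rightarrow> real" and c :: "'j::finite \<Rightarrow> real" and J :: "'b \<Rightarrow> 'j set"
  assumes "finite S" and w: "\<And>b. b \<in> S \<Longrightarrow> 0 \<le> w b" "sum w S = 1" and c: "\<And>j. 0 \<le> c j"
  shows "(\<Prod>j\<in>UNIV. c j powr (\<Sum>b\<in>S. w b * indicator (J b) j)) \<le> (\<Sum>b\<in>S. w b * (\<Prod>j\<in>J b. c j))"
proof (cases "\<exists>j. c j = 0")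
  case True
  then have "(\<Prod>j\<in>UNIV. c j powr (\<Sum>b\<in>S. w b * indicator (J b) j)) = 0"
    by (auto intro!: prod_zero)
  also have "\<dots> \<le> (\<Sum>b\<in>S. w b * (\<Prod>j\<in>J b. c j))"
    using w c by (simp add: sum_nonneg prod_nonneg)
  finally show ?thesis .
next
  case False
  with c have pos: "0 < c j" for j by (metis order_le_less)
  let ?y = "\<lambda>b. \<Sum>j\<in>J b. ln (c j)"
  have "(\<Sum>j\<in>UNIV. (\<Sum>b\<in>S. w b * indicator (J b) j) * ln (c j)) = (\<Sum>b\<in>S. w b * ?y b)"
  proof -
    have "w b * ?y b = (\<Sum>j\<in>UNIV. w b * indicator (J b) j * ln (c j))" for b
      unfolding sum_distrib_left by (rule sum.mono_neutral_cong_left) auto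
    then show ?thesis
      by (simp add: sum_distrib_right, subst sum.swap) simp
  qed
  then have "(\<Prod>j\<in>UNIV. c j powr (\<Sum>b\<in>S. w b * indicator (J b) j)) = exp (\<Sum>b\<in>S. w b *\<^sub>R ?y b)"
    using pos by (simp add: powr_def exp_sum[symmetric] less_imp_neq[THEN not_sym])
  also have "\<dots> \<le> (\<Sum>b\<in>S. w b * exp (?y b))"
  proof -
    have "S \<noteq> {}" using w(2) by auto
    then show ?thesis
      using convex_on_sum[OF \<open>finite S\<close> _ exp_convex w(2), of ?y] w(1) by simp
  qed
  also have "\<dots> = (\<Sum>b\<in>S. w b * (\<Prod>j\<in>J b. c j))"
    using pos by (simp add: exp_sum)
  finally show ?thesis .
qed

section \<open>Normalization of a function with respect to its norm\<close>

lemma Lnorm_zero_bound: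
  fixes a :: "real^'l \<Rightarrow> complex"
  assumes "a \<in> L1_Linf"
  shows AE_norm_le_Lnorm_zero: "AE y in lebesgue. norm (a y) \<le> Lnorm 0 a" and "0 \<le> Lnorm 0 a"
proof -
  let ?E = "esssup lebesgue (\<lambda>y. ereal (norm (a y)))"
  have "?E < \<infinity>" using assms by (simp add: L1_Linf_def)
  then have "norm (a y) \<le> real_of_ereal ?E" if "ereal (norm (a y)) \<le> ?E" for y
    using that by (cases ?E) auto
  then show *: "AE y in lebesgue. norm (a y) \<le> Lnorm 0 a"
    using esssup_AE[of "\<lambda>y. ereal (norm (a y))" lebesgue] by (auto simp: Lnorm_def elim: eventually_mono)
  then have "AE y in lebesgue. 0 \<le> Lnorm 0 a \<and> (y :: real^'l) \<in> UNIV"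
    by eventually_elim (auto intro: order_trans[OF norm_ge_zero])
  moreover have "ae_filter (lebesgue :: (real^'l) measure) \<noteq> bot"
    by (simp add: ae_filter_eq_bot_iff)
  ultimately show "0 \<le> Lnorm 0 a" by (simp add: eventually_const)
qed

lemma Lnorm_nonneg: "a \<in> L1_Linf \<Longrightarrow> 0 \<le> Lnorm \<theta> a"
  using Lnorm_zero_bound(2)[of a] by (cases "\<theta> = 0") (auto simp: Lnorm_def)

text \<open>
  On a function in \<open>L\<^sup>1\<close> that is essentially bounded by \<open>R\<close>, the powers satisfy
  \<open>\<bar>a\<bar>\<^sup>p \<le> R\<^sup>p\<^sup>-\<^sup>1 \<bar>a\<bar>\<close>. Thus the integral in \<open>Lnorm \<theta>\<close> converges for \<open>0 < \<theta> \<le> 1\<close>;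
  otherwise it would be \<open>0\<close> by default.
\<close>

lemma integrable_norm_powr:
  assumes a: "a \<in> L1_Linf" and "1 \<le> p"
  shows "integrable lebesgue (\<lambda>y. norm (a y) powr p)"
proof (rule Bochner_Integration.integrable_bound)
  have int: "integrable lebesgue a" using a by (simp add: L1_Linf_def)
  then have [measurable]: "a \<in> borel_measurable lebesgue" by auto
  show "integrable lebesgue (\<lambda>y. Lnorm 0 a powr (p - 1) * norm (a y))"
    using int by simp
  show "(\<lambda>y. norm (a y) powr p) \<in> borel_measurable lebesgue" by measurable
  have "norm (a y) powr p \<le> Lnorm 0 a powr (p - 1) * norm (a y)" if "norm (a y) \<le> Lnorm 0 a" for y
  proof -
    have "norm (a y) powr p = norm (a y) powr (p - 1) * norm (a y)"
      using powr_add[of "norm (a y)" "p - 1" 1] by simp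
    also have "\<dots> \<le> Lnorm 0 a powr (p - 1) * norm (a y)"
      using that \<open>1 \<le> p\<close> by (intro mult_right_mono powr_mono2) auto
    finally show ?thesis .
  qed
  then show "AE y in lebesgue. norm (norm (a y) powr p) \<le> norm (Lnorm 0 a powr (p - 1) * norm (a y))"
    using AE_norm_le_Lnorm_zero[OF a] by (auto elim!: eventually_mono simp: abs_mult)
qed

text \<open>
  The function \<open>c\<close> is \<open>\<bar>a\<bar> powr (1 / \<theta>)\<close> divided by its integral, in a Borel version. With it, the dependence
  of \<open>a\<close> on the exponent is isolated in \<open>c powr \<theta>\<close>, to which the inequality of means applies, and the bound
  on the integral of \<open>c\<close> does not involve \<open>\<theta>\<close>. For \<open>\<theta> = 0\<close> the choice \<open>c = 1\<close> expresses the
  essential bound; its integral is infinite. If \<open>\<theta> > 0\<close> and \<open>a\<close> vanishes almost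
  everywhere then \<open>c = 0\<close> avoids the division by zero.
\<close>

lemma normalized_profile:
  fixes a :: "real^'l \<Rightarrow> complex"
  assumes a: "a \<in> L1_Linf" and "0 \<le> \<theta>" "\<theta> \<le> 1"
  shows "\<exists>c\<in>borel_measurable borel. (\<forall>y. 0 \<le> c y) \<and>
    (0 < \<theta> \<longrightarrow> (\<integral>\<^sup>+y. ennreal (c y) \<partial>lborel) \<le> 1) \<and>
    (AE y in lborel. norm (a y) \<le> Lnorm \<theta> a * c y powr \<theta>)"
proof (cases "\<theta> = 0")
  case True
  then show ?thesis
    using AE_norm_le_Lnorm_zero[OF a] by (intro bexI[of _ "\<lambda>_. 1"]) (auto simp: AE_completion_iff)
next
  case False
  with assms have th: "0 < \<theta>" by simp
  define b where "b y = norm (a y) powr (1 / \<theta>)" for y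
  have int: "integrable lebesgue b"
    unfolding b_def using th assms(3) by (intro integrable_norm_powr[OF a]) simp
  have b_nonneg: "0 \<le> b y" for y by (simp add: b_def)
  define I where "I = (\<integral>y. b y \<partial>lebesgue)"
  have "0 \<le> I" unfolding I_def by (simp add: b_nonneg)
  have N: "Lnorm \<theta> a = I powr \<theta>" using th by (simp add: Lnorm_def I_def b_def)
  have norm_a: "norm (a y) = b y powr \<theta>" for y
    using th by (simp add: b_def powr_powr)
  show ?thesis
  proof (cases "I = 0")
    case True
    then have "AE y in lebesgue. b y = 0"
      using integral_nonneg_eq_0_iff_AE[OF int] unfolding I_def by (simp add: b_def)
    then show ?thesis
      by (intro bexI[of _ "\<lambda>_. 0"]) (auto simp: AE_completion_iff norm_a elim!: eventually_mono)
  next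
    case False
    with \<open>0 \<le> I\<close> have "0 < I" by simp
    obtain b' where b': "b' \<in> borel_measurable lborel" "AE y in lborel. b y = b' y"
      using completion_ex_borel_measurable_real[OF borel_measurable_integrable[OF int]] by auto
    have [measurable]: "b' \<in> borel_measurable borel" using b'(1) by simp
    define c where "c y = max 0 (b' y) / I" for y
    have bc: "AE y in lborel. b y = I * c y"
      using b'(2)
    proof eventually_elim
      case (elim y)
      with b_nonneg[of y] \<open>0 < I\<close> show ?case by (simp add: c_def)
    qed
    have "(\<integral>\<^sup>+y. ennreal (c y) \<partial>lborel) = (\<integral>\<^sup>+y. ennreal (b y / I) \<partial>lborel)"
    proof (rule nn_integral_cong_AE)
      show "AE y in lborel. ennreal (c y) = ennreal (b y / I)"
        using bc by eventually_elim (use \<open>0 < I\<close> in simp)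
    qed
    also have "\<dots> = (\<integral>\<^sup>+y. ennreal (b y / I) \<partial>lebesgue)"
      by (rule nn_integral_completion[symmetric])
    also have "\<dots> = ennreal (\<integral>y. b y / I \<partial>lebesgue)"
      by (rule nn_integral_eq_integral) (use \<open>0 < I\<close> int in \<open>simp_all add: b_nonneg\<close>)
    also have "\<dots> = 1" using \<open>0 < I\<close> by (simp add: I_def)
    finally have "(\<integral>\<^sup>+y. ennreal (c y) \<partial>lborel) = 1" .
    moreover have "AE y in lborel. norm (a y) \<le> Lnorm \<theta> a * c y powr \<theta>"
      using bc
    proof eventually_elim
      case (elim y)
      have "norm (a y) = (I * c y) powr \<theta>" by (simp only: norm_a elim)
      also have "\<dots> = I powr \<theta> * c y powr \<theta>"
        by (rule powr_mult)
      finally show ?case by (simp add: N)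
    qed
    moreover have "c \<in> borel_measurable borel" unfolding c_def by measurable
    moreover have "0 \<le> c y" for y using \<open>0 < I\<close> by (simp add: c_def)
    ultimately show ?thesis by (intro bexI[of _ c]) auto
  qed
qed

section \<open>The inequality on the matroid polytope\<close>

text \<open>
  The indices in \<open>f -` B\<close> correspond to the rows of the matrix of \<open>B\<close>, since \<open>f\<close> is injective; the
  integral then factors into \<open>\<bar>det\<bar>\<^sup>-\<^sup>l\<close> and the integrals of the \<open>c j\<close>.
\<close>

lemma nn_integral_prod_basis_le:
  fixes f :: "'m::finite \<Rightarrow> real^'k" and c :: "'m \<Rightarrow> real^'l \<Rightarrow> real"
  assumes f: "inj f" and B: "B \<in> bases (range f)"
    and c: "\<And>j. c j \<in> borel_measurable borel" "\<And>j y. 0 \<le> c j y"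
    and le1: "\<And>j. f j \<in> B \<Longrightarrow> (\<integral>\<^sup>+y. ennreal (c j y) \<partial>lborel) \<le> 1"
  shows "(\<integral>\<^sup>+x. ennreal (\<Prod>j\<in>f -` B. c j (fdot (f j) x)) \<partial>lborel) \<le> ennreal (det_const CARD('l) (range f))"
proof -
  define A where "A = basis_matrix B"
  define \<sigma> where "\<sigma> i = inv f (A $ i)" for i
  have range: "range (\<lambda>i. A $ i) = B" and inj: "inj (\<lambda>i. A $ i)" and det: "det A \<noteq> 0"
    unfolding A_def by (fact rows_basis_matrix[OF B] inj_basis_matrix[OF B] det_basis_matrix_nonzero[OF B])+
  have "B \<subseteq> range f" using B by (simp add: bases_def)
  then have "A $ i \<in> range f" for i using range by blast
  then have f\<sigma>: "f (\<sigma> i) = A $ i" for i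
    unfolding \<sigma>_def by (rule f_inv_into_f)
  have "inj \<sigma>" using inj f\<sigma> by (metis (mono_tags, lifting) injD injI)
  moreover have "range \<sigma> = f -` B"
  proof safe
    fix j assume "f j \<in> B"
    then obtain i where "A $ i = f j" using range by auto
    then have "\<sigma> i = j" using f by (simp add: \<sigma>_def)
    then show "j \<in> range \<sigma>" by auto
  qed (use f\<sigma> range in auto)
  ultimately have \<sigma>: "bij_betw \<sigma> UNIV (f -` B)" by (simp add: bij_betw_def)
  have "(\<Prod>j\<in>f -` B. c j (fdot (f j) x)) = (\<Prod>i\<in>UNIV. c (\<sigma> i) (fdot (A $ i) x))" for x
    using prod.reindex_bij_betw[OF \<sigma>, of "\<lambda>j. c j (fdot (f j) x)"] by (simp add: f\<sigma>)
  then have "(\<integral>\<^sup>+x. ennreal (\<Prod>j\<in>f -` B. c j (fdot (f j) x)) \<partial>lborel)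
      = (\<integral>\<^sup>+x. (\<Prod>i\<in>UNIV. ennreal (c (\<sigma> i) (fdot (A $ i) x))) \<partial>lborel)"
    using c(2) by (simp add: prod_ennreal)
  also have "\<dots> = ennreal (\<bar>det A\<bar> powi (- int CARD('l))) * (\<Prod>i\<in>UNIV. \<integral>\<^sup>+y. ennreal (c (\<sigma> i) y) \<partial>lborel)"
    using c(1) det by (intro nn_integral_prod_row_action) auto
  also have "\<dots> \<le> ennreal (\<bar>det A\<bar> powi (- int CARD('l))) * 1"
    using range f\<sigma> le1 by (intro mult_left_mono prod_le_1) auto
  also have "\<dots> \<le> ennreal (det_const CARD('l) (range f))"
    using det_const_ge[OF _ B] by (auto simp: A_def intro: ennreal_leI)
  finally show ?thesis .
qed

text \<open>
  A convex combination of the vertices is indexed by the bases themselves, since a basis contained in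
  \<open>range f\<close> is determined by its indicator vector.
\<close>

lemma matroid_polytope_weights:
  fixes f :: "'m::finite \<Rightarrow> real^'k"
  assumes "\<theta> \<in> matroid_polytope f"
  obtains w where "\<And>B. B \<in> bases (range f) \<Longrightarrow> 0 \<le> w B" "sum w (bases (range f)) = 1"
    "\<And>j. \<theta> $ j = (\<Sum>B\<in>bases (range f). w B * indicator (f -` B) j)"
proof -
  let ?S = "bases (range f)"
  have fin: "finite ?S" by (simp add: finite_bases)
  have inj: "inj_on (chi_vec f) ?S"
  proof (rule inj_onI)
    fix B B' assume "B \<in> ?S" "B' \<in> ?S" and eq: "chi_vec f B = chi_vec f B'"
    then have "B \<subseteq> range f" "B' \<subseteq> range f" by (auto simp: bases_def)
    moreover have "f j \<in> B \<longleftrightarrow> f j \<in> B'" for j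
      using arg_cong[OF eq, of "\<lambda>v. v $ j"] by (simp add: chi_vec_def split: if_splits)
    ultimately show "B = B'" by blast
  qed
  obtain u where u: "\<And>x. x \<in> chi_vec f ` ?S \<Longrightarrow> 0 \<le> u x" "sum u (chi_vec f ` ?S) = 1"
    "(\<Sum>x\<in>chi_vec f ` ?S. u x *\<^sub>R x) = \<theta>"
    using assms fin by (auto simp: matroid_polytope_def convex_hull_finite)
  show ?thesis
  proof
    show "0 \<le> (u \<circ> chi_vec f) B" if "B \<in> ?S" for B using u(1) that by simp
    show "sum (u \<circ> chi_vec f) ?S = 1" using u(2) by (simp add: sum.reindex[OF inj])
    show "\<theta> $ j = (\<Sum>B\<in>?S. (u \<circ> chi_vec f) B * indicator (f -` B) j)" for j
    proof -
      have "\<theta> $ j = (\<Sum>B\<in>?S. u (chi_vec f B) * chi_vec f B $ j)"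
        unfolding u(3)[symmetric] by (simp add: sum.reindex[OF inj])
      also have "\<dots> = (\<Sum>B\<in>?S. (u \<circ> chi_vec f) B * indicator (f -` B) j)"
        by (intro sum.cong) (auto simp: chi_vec_def indicator_def)
      finally show ?thesis .
    qed
  qed
qed

theorem corollary2p2:
  fixes f :: "'m::finite \<Rightarrow> real^'k"
    and \<theta> :: "real^'m"
    and a :: "'m \<Rightarrow> real^'l \<Rightarrow> complex"
  assumes "inj f"
    and "\<And>j. f j \<noteq> 0"
    and "\<theta> \<in> matroid_polytope f"
    and "\<And>j. a j \<in> L1_Linf"
  shows "integrable lebesgue (\<lambda>x. \<Prod>j\<in>UNIV. a j (fdot (f j) x)) \<and>
    norm (Lambda_form f a) \<le> det_const CARD('l) (range f) * (\<Prod>i\<in>UNIV. Lnorm (\<theta> $ i) (a i))"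
proof -
  let ?S = "bases (range f)"
  let ?C = "det_const CARD('l) (range f)"
  let ?N = "\<Prod>i\<in>UNIV. Lnorm (\<theta> $ i) (a i)"
  let ?F = "\<lambda>x. \<Prod>j\<in>UNIV. a j (fdot (f j) x)"
  obtain w where w: "\<And>B. B \<in> ?S \<Longrightarrow> 0 \<le> w B" "sum w ?S = 1"
    and \<theta>: "\<And>j. \<theta> $ j = (\<Sum>B\<in>?S. w B * indicator (f -` B) j)"
    using matroid_polytope_weights[OF assms(3)] by blast
  have "?S \<noteq> {}" using w(2) by auto
  have fin: "finite ?S" by (simp add: finite_bases)
  have \<theta>_bounds: "0 \<le> \<theta> $ j" "\<theta> $ j \<le> 1" for j
  proof -
    show "0 \<le> \<theta> $ j" unfolding \<theta> using w(1) by (intro sum_nonneg) auto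
    have "\<theta> $ j \<le> sum w ?S"
      unfolding \<theta> using w(1) by (intro sum_mono) (auto simp: indicator_def)
    then show "\<theta> $ j \<le> 1" using w(2) by simp
  qed
  let ?profile = "\<lambda>j c. c \<in> borel_measurable borel \<and> (\<forall>y. 0 \<le> c y) \<and>
    (0 < \<theta> $ j \<longrightarrow> (\<integral>\<^sup>+y. ennreal (c y) \<partial>lborel) \<le> 1) \<and>
    (AE y in lborel. norm (a j y) \<le> Lnorm (\<theta> $ j) (a j) * c y powr (\<theta> $ j))"
  have "\<forall>j. \<exists>c. ?profile j c"
    using normalized_profile[OF assms(4) \<theta>_bounds] unfolding Bex_def by blast
  then obtain c where "\<And>j. ?profile j (c j)"
    using choice[of ?profile] by blast
  then have c [measurable]: "\<And>j. c j \<in> borel_measurable borel"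
    and c_nonneg: "\<And>j y. 0 \<le> c j y"
    and c_int: "\<And>j. 0 < \<theta> $ j \<Longrightarrow> (\<integral>\<^sup>+y. ennreal (c j y) \<partial>lborel) \<le> 1"
    and c_bound: "\<And>j. AE y in lborel. norm (a j y) \<le> Lnorm (\<theta> $ j) (a j) * c j y powr (\<theta> $ j)"
    by blast+
  have "0 \<le> ?N" using assms(4) by (intro prod_nonneg Lnorm_nonneg) auto
  have "AE x in lborel. \<forall>j. norm (a j (fdot (f j) x)) \<le> Lnorm (\<theta> $ j) (a j) * c j (fdot (f j) x) powr (\<theta> $ j)"
    using AE_lborel_fdot[OF assms(2) c_bound] by (simp add: AE_all_countable)
  then have dom: "AE x in lborel. norm (?F x) \<le> ?N * (\<Sum>B\<in>?S. w B * (\<Prod>j\<in>f -` B. c j (fdot (f j) x)))"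
  proof eventually_elim
    case (elim x)
    have "norm (?F x) \<le> (\<Prod>j\<in>UNIV. Lnorm (\<theta> $ j) (a j) * c j (fdot (f j) x) powr (\<theta> $ j))"
      unfolding prod_norm[symmetric] using elim by (intro prod_mono) auto
    also have "\<dots> = ?N * (\<Prod>j\<in>UNIV. c j (fdot (f j) x) powr (\<theta> $ j))" by (rule prod.distrib)
    also have "\<dots> \<le> ?N * (\<Sum>B\<in>?S. w B * (\<Prod>j\<in>f -` B. c j (fdot (f j) x)))"
      unfolding \<theta> using fin w c_nonneg \<open>0 \<le> ?N\<close>
      by (intro mult_left_mono prod_powr_le_weighted_sum) (auto simp: \<theta>[symmetric])
    finally show ?case .
  qed
  \<comment> \<open>A basis of weight \<open>0\<close> may contain some \<open>f j\<close> with \<open>\<theta> $ j = 0\<close>, for which \<open>c j\<close> need not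
    be integrable. Its term is \<open>0\<close> nevertheless, since \<open>0 * \<infinity> = 0\<close> in \<open>ennreal\<close>.\<close>
  have basis: "ennreal (w B) * (\<integral>\<^sup>+x. ennreal (\<Prod>j\<in>f -` B. c j (fdot (f j) x)) \<partial>lborel)
      \<le> ennreal (w B) * ennreal ?C" if "B \<in> ?S" for B
  proof (cases "w B = 0")
    case False
    have "0 < \<theta> $ j" if "f j \<in> B" for j
    proof -
      have "w B * indicator (f -` B) j \<le> \<theta> $ j"
        unfolding \<theta> using fin w(1) \<open>B \<in> ?S\<close> by (intro member_le_sum) auto
      with False w(1)[OF \<open>B \<in> ?S\<close>] that show ?thesis by simp
    qed
    then show ?thesis
      using \<open>B \<in> ?S\<close> by (intro mult_left_mono nn_integral_prod_basis_le assms(1) c c_nonneg c_int) auto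
  qed simp
  have "(\<integral>\<^sup>+x. ennreal (norm (?F x)) \<partial>lborel)
      \<le> (\<integral>\<^sup>+x. ennreal (?N * (\<Sum>B\<in>?S. w B * (\<Prod>j\<in>f -` B. c j (fdot (f j) x)))) \<partial>lborel)"
    using dom by (intro nn_integral_mono_AE) (auto elim!: eventually_mono intro: ennreal_leI)
  also have "\<dots> = (\<integral>\<^sup>+x. ennreal ?N * (\<Sum>B\<in>?S. ennreal (w B) * ennreal (\<Prod>j\<in>f -` B. c j (fdot (f j) x))) \<partial>lborel)"
    using \<open>0 \<le> ?N\<close> w(1) c_nonneg
    by (simp add: ennreal_mult' ennreal_mult sum_nonneg prod_nonneg flip: sum_ennreal)
  also have "\<dots> = ennreal ?N * (\<Sum>B\<in>?S. ennreal (w B) * (\<integral>\<^sup>+x. ennreal (\<Prod>j\<in>f -` B. c j (fdot (f j) x)) \<partial>lborel))"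
    by (simp add: nn_integral_cmult nn_integral_sum)
  also have "\<dots> \<le> ennreal ?N * (\<Sum>B\<in>?S. ennreal (w B) * ennreal ?C)"
    by (rule mult_left_mono[OF sum_mono[OF basis]]) auto
  also have "\<dots> = ennreal ?N * ennreal ?C"
  proof -
    have "(\<Sum>B\<in>?S. ennreal (w B)) = 1" using w by (subst sum_ennreal) auto
    then show ?thesis unfolding sum_distrib_right[symmetric] by simp
  qed
  also have "\<dots> = ennreal (?C * ?N)" using \<open>0 \<le> ?N\<close> by (simp add: ennreal_mult'' mult.commute)
  finally have bound: "(\<integral>\<^sup>+x. ennreal (norm (?F x)) \<partial>lebesgue) \<le> ennreal (?C * ?N)"
    by (simp add: nn_integral_completion)
  have "(\<lambda>x. a j (fdot (f j) x)) \<in> borel_measurable lebesgue" for j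
    using assms(4)[of j] by (intro measurable_compose[OF measurable_fdot_lebesgue[OF assms(2)]])
      (auto simp: L1_Linf_def)
  then have "?F \<in> borel_measurable lebesgue" by (intro borel_measurable_prod)
  then have int: "integrable lebesgue ?F"
    using bound by (intro integrableI_bounded) (auto intro: le_less_trans)
  have "0 \<le> ?C"
  proof -
    obtain B where "B \<in> ?S" using \<open>?S \<noteq> {}\<close> by blast
    then have "\<bar>det (basis_matrix B)\<bar> powi (- int CARD('l)) \<le> ?C"
      by (intro det_const_ge) auto
    moreover have "0 \<le> \<bar>det (basis_matrix B)\<bar> powi (- int CARD('l))" by simp
    ultimately show ?thesis by linarith
  qed
  then have "norm (Lambda_form f a) \<le> ?C * ?N"
    using order_trans[OF integral_norm_bound_ennreal[OF int] bound] \<open>0 \<le> ?N\<close>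
    by (simp add: Lambda_form_def)
  with int show ?thesis by blast
qed

end
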